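(* Let $x\in[D]^T$ be a document of length $T$, let $S\subseteq[T]$, and let $\tilde x\in B_S(x)$. Let $\varphi$ be the concatenation embedding with token embedding $u_e$, positional embedding $u_p$ and maximal document size $T_{\max}$. Then $$\|\varphi(x)-\varphi(\tilde x)\|\;\le\;\max_{j\neq k}\|u_e(j)-u_e(k)\|\cdot\sqrt{\min(|S|,T_{\max})},$$ where the maximum is over distinct tokens $j,k\in[D]$.
   Context: Notation: $\|\cdot\|$ is the Euclidean norm, $[n]=\{1,\dots,n\}$. The dictionary is $[D]$, and a document of length $T$ is an element $x=(x_1,\dots,x_T)\in[D]^T$. For $x\in[D]^T$ and $S\subseteq[T]$, $B_S(x)=\{\tilde x\in[D]^T: \tilde x_t=x_t \text{ for all } t\notin S\}$. Concatenation embedding: let $u_e:[D]\to\mathbb{R}^{d_e}$ (token embedding) and $u_p:\{1,2,\dots\}\to\mathbb{R}^{d_p}$ (positional embedding) be given maps, let $d=d_e+d_p$, and let $u(j,t)=[u_e(j);u_p(t)]\in\mathbb{R}^d$ (vertical concatenation). Fix a maximal document size $T_{\max}\ge 1$. For a document $x$ of length $T$, the embedding $\varphi(x)\in\mathbb{R}^{dT_{\max}}$ is $\varphi(x)=[u(x_1,1);\dots;u(x_{T_{\max}},T_{\max})]$ if $T\ge T_{\max}$, and $\varphi(x)=[u(x_1,1);\dots;u(x_T,T);0;\dots;0]$ (zero-padding) if $T<T_{\max}$. *)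

theory Defs
  imports Complex_Main "HOL-Library.FuncSet" "Jordan_Normal_Form.Matrix"
begin

(* A token is an element of {1..D}; a document of length T is an extensional function
   on {1..T} (1-based positions). *)
definition documents :: "nat \<Rightarrow> nat \<Rightarrow> (nat \<Rightarrow> nat) set" where
  "documents D T = {1..T} \<rightarrow>\<^sub>E {1..D}"

definition perturbations :: "nat \<Rightarrow> nat \<Rightarrow> nat set \<Rightarrow> (nat \<Rightarrow> nat) \<Rightarrow> (nat \<Rightarrow> nat) set" where
  "perturbations D T S x = {x' \<in> documents D T. \<forall>t\<in>{1..T}. t \<notin> S \<longrightarrow> x' t = x t}"

definition euclidean_norm :: "real vec \<Rightarrow> real" where
  "euclidean_norm v = sqrt (v \<bullet> v)"

definition concat_vecs :: "real vec list \<Rightarrow> real vec" where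
  "concat_vecs vs = foldr (@\<^sub>v) vs (0\<^sub>v 0)"

definition token_position_embedding ::
  "(nat \<Rightarrow> real vec) \<Rightarrow> (nat \<Rightarrow> real vec) \<Rightarrow> nat \<Rightarrow> nat \<Rightarrow> real vec" where
  "token_position_embedding u_e u_p j t = u_e j @\<^sub>v u_p t"

(* The length T of the document x is passed explicitly; d_e and d_p only fix the
   amount of zero-padding. *)
definition concat_embedding ::
  "nat \<Rightarrow> nat \<Rightarrow> (nat \<Rightarrow> real vec) \<Rightarrow> (nat \<Rightarrow> real vec) \<Rightarrow> nat \<Rightarrow> nat \<Rightarrow> (nat \<Rightarrow> nat) \<Rightarrow> real vec" where
  "concat_embedding d_e d_p u_e u_p T_max T x =
    (if T \<ge> T_max
     then concat_vecs (map (\<lambda>t. token_position_embedding u_e u_p (x t) t) [1..<T_max + 1])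
     else concat_vecs (map (\<lambda>t. token_position_embedding u_e u_p (x t) t) [1..<T + 1])
          @\<^sub>v 0\<^sub>v ((d_e + d_p) * (T_max - T)))"

(* For D < 2 there are no distinct tokens; the maximum over the empty family of
   (nonnegative) distances is read as 0, since Max {} is unspecified. *)
definition max_token_distance :: "nat \<Rightarrow> (nat \<Rightarrow> real vec) \<Rightarrow> real" where
  "max_token_distance D u_e =
    (if D \<ge> 2
     then Max {euclidean_norm (u_e j - u_e k) | j k. j \<in> {1..D} \<and> k \<in> {1..D} \<and> j \<noteq> k}
     else 0)"

lemma concat_vecs_carrier:
  "(\<And>v. v \<in> set vs \<Longrightarrow> v \<in> carrier_vec d) \<Longrightarrow> concat_vecs vs \<in> carrier_vec (d * length vs)"
proof (induction vs)
  case (Cons v vs)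
  have "v @\<^sub>v concat_vecs vs \<in> carrier_vec (d + d * length vs)"
    using Cons by (intro append_carrier_vec) auto
  then show ?case by (simp add: concat_vecs_def)
qed (simp add: concat_vecs_def)

(* Confirms that the embedding takes values in R^(d * T_max). *)
lemma concat_embedding_carrier:
  assumes x: "x \<in> documents D T"
    and e: "u_e \<in> {1..D} \<rightarrow> carrier_vec d_e" and p: "u_p \<in> {1..} \<rightarrow> carrier_vec d_p"
  shows "concat_embedding d_e d_p u_e u_p T_max T x \<in> carrier_vec ((d_e + d_p) * T_max)"
proof -
  have u: "token_position_embedding u_e u_p (x t) t \<in> carrier_vec (d_e + d_p)"
    if "t \<in> {1..T}" for t
  proof -
    have "x t \<in> {1..D}" using x that unfolding documents_def by (rule PiE_mem)
    then have "u_e (x t) \<in> carrier_vec d_e" using e by (rule funcset_mem[rotated])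
    moreover have "u_p t \<in> carrier_vec d_p" using p that by (auto intro: funcset_mem)
    ultimately show ?thesis by (simp add: token_position_embedding_def)
  qed
  have c: "concat_vecs (map (\<lambda>t. token_position_embedding u_e u_p (x t) t) [1..<n + 1])
      \<in> carrier_vec ((d_e + d_p) * n)" if "n \<le> T" for n
  proof -
    have "concat_vecs (map (\<lambda>t. token_position_embedding u_e u_p (x t) t) [1..<n + 1])
      \<in> carrier_vec ((d_e + d_p) * length (map (\<lambda>t. token_position_embedding u_e u_p (x t) t) [1..<n + 1]))"
    proof (rule concat_vecs_carrier)
      fix v
      assume "v \<in> set (map (\<lambda>t. token_position_embedding u_e u_p (x t) t) [1..<n + 1])"
      then obtain t where "t \<in> {1..T}" "v = token_position_embedding u_e u_p (x t) t"
        using \<open>n \<le> T\<close> by fastforce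
      with u show "v \<in> carrier_vec (d_e + d_p)" by simp
    qed
    then show ?thesis by (simp only: length_map length_upt diff_add_inverse2)
  qed
  show ?thesis
  proof (cases "T \<ge> T_max")
    case True
    then show ?thesis using c[OF True] by (simp add: concat_embedding_def del: upt_Suc)
  next
    case False
    have "(d_e + d_p) * T_max = (d_e + d_p) * T + (d_e + d_p) * (T_max - T)"
      using False by (metis add_mult_distrib2 le_add_diff_inverse nat_le_linear)
    then show ?thesis
      using append_carrier_vec[OF c[OF order_refl] zero_carrier_vec] False
      by (simp add: concat_embedding_def del: upt_Suc)
  qed
qed

end

theory Submission
  imports Defs
begin

text \<open>The squared Euclidean norm is additive over vertically stacked blocks, so the squared
  distance between two embeddings is a sum of squared block distances, one per position t up to
  \<open>min T T_max\<close>. Both documents have the same length, so zero-padding cancels, and the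
  block at t carries the same positional vector in both, leaving only the squared distance of the
  token vectors (\<open>scalar_prod_self_concat_embedding_diff\<close>). Positions outside S hold
  equal tokens and contribute 0. At most \<open>min (card S) T_max\<close> positions remain, each
  contributing at most the square of the maximal token distance
  (\<open>euclidean_norm_le_max_token_distance\<close>). A square root gives the bound.\<close>

lemma append_vec_minus:
  fixes a :: "'a::group_add vec"
  assumes "a \<in> carrier_vec m" "a' \<in> carrier_vec m" "b \<in> carrier_vec n" "b' \<in> carrier_vec n"
  shows "(a @\<^sub>v b) - (a' @\<^sub>v b') = (a - a') @\<^sub>v (b - b')"
  using assms by (intro eq_vecI) auto

text \<open>Pythagoras for stacked blocks; the induction over positions, the cancellation of
  positional vectors and that of the padding all rest on it.\<close>

lemma scalar_prod_self_append_diff: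
  fixes a :: "'a::ring vec"
  assumes "a \<in> carrier_vec m" "a' \<in> carrier_vec m" "b \<in> carrier_vec n" "b' \<in> carrier_vec n"
  shows "((a @\<^sub>v b) - (a' @\<^sub>v b')) \<bullet> ((a @\<^sub>v b) - (a' @\<^sub>v b'))
    = (a - a') \<bullet> (a - a') + (b - b') \<bullet> (b - b')"
  using assms by (simp add: append_vec_minus scalar_prod_append[where ?n1.0 = m and ?n2.0 = n])

lemma scalar_prod_self_concat_vecs_diff:
  assumes "\<And>t. t \<in> set ts \<Longrightarrow> f t \<in> carrier_vec n" "\<And>t. t \<in> set ts \<Longrightarrow> g t \<in> carrier_vec n"
  shows "(concat_vecs (map f ts) - concat_vecs (map g ts))
      \<bullet> (concat_vecs (map f ts) - concat_vecs (map g ts))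
    = (\<Sum>t\<leftarrow>ts. (f t - g t) \<bullet> (f t - g t))"
  using assms
proof (induction ts)
  case (Cons t ts)
  have "concat_vecs (map h ts) \<in> carrier_vec (n * length ts)"
    if "\<And>t. t \<in> set ts \<Longrightarrow> h t \<in> carrier_vec n" for h
    using concat_vecs_carrier[of "map h ts" n] that by auto
  then have "concat_vecs (map f ts) \<in> carrier_vec (n * length ts)"
      "concat_vecs (map g ts) \<in> carrier_vec (n * length ts)"
    using Cons.prems by simp_all
  moreover have "concat_vecs (map h (t # ts)) = h t @\<^sub>v concat_vecs (map h ts)" for h
    by (simp add: concat_vecs_def)
  ultimately show ?case
    using Cons by (simp add: scalar_prod_self_append_diff[where m = n and n = "n * length ts"])
qed (simp add: concat_vecs_def)

lemma scalar_prod_self_token_position_diff: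
  assumes "u_e j \<in> carrier_vec d_e" "u_e k \<in> carrier_vec d_e" "u_p t \<in> carrier_vec d_p"
  shows "(token_position_embedding u_e u_p j t - token_position_embedding u_e u_p k t)
      \<bullet> (token_position_embedding u_e u_p j t - token_position_embedding u_e u_p k t)
    = (u_e j - u_e k) \<bullet> (u_e j - u_e k)"
  using assms
  by (simp add: token_position_embedding_def
      scalar_prod_self_append_diff[where m = d_e and n = d_p])

text \<open>Truncation and padding are treated together: in either case the embedding starts with
  the blocks of the first \<open>min T T_max\<close> positions, and any padding is the same zero
  vector on both sides.\<close>

lemma scalar_prod_self_concat_embedding_diff:
  assumes e: "u_e \<in> {1..D} \<rightarrow> carrier_vec d_e" and p: "u_p \<in> {1..} \<rightarrow> carrier_vec d_p"
    and x: "x \<in> documents D T" and y: "y \<in> documents D T"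
  shows "(concat_embedding d_e d_p u_e u_p T_max T x - concat_embedding d_e d_p u_e u_p T_max T y)
      \<bullet> (concat_embedding d_e d_p u_e u_p T_max T x - concat_embedding d_e d_p u_e u_p T_max T y)
    = (\<Sum>t\<in>{1..min T T_max}. (u_e (x t) - u_e (y t)) \<bullet> (u_e (x t) - u_e (y t)))"
proof -
  let ?n = "min T T_max"
  let ?f = "\<lambda>z t. token_position_embedding u_e u_p (z t) t"
  let ?c = "\<lambda>z. concat_vecs (map (?f z) [1..<?n + 1])"
  have ue: "u_e (z t) \<in> carrier_vec d_e" if "z \<in> documents D T" "t \<in> {1..T}" for z t
    using e that unfolding documents_def by blast
  have f: "?f z t \<in> carrier_vec (d_e + d_p)" if "z \<in> documents D T" "t \<in> {1..T}" for z t
    using ue[OF that] p that(2) by (auto simp: token_position_embedding_def)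
  have c: "?c z \<in> carrier_vec ((d_e + d_p) * ?n)" if "z \<in> documents D T" for z
  proof -
    have "v \<in> carrier_vec (d_e + d_p)" if "v \<in> set (map (?f z) [1..<?n + 1])" for v
      using that f[OF \<open>z \<in> documents D T\<close>] by (auto simp del: upt_Suc)
    then have "?c z \<in> carrier_vec ((d_e + d_p) * length (map (?f z) [1..<?n + 1]))"
      by (rule concat_vecs_carrier)
    then show ?thesis
      by (simp del: upt_Suc)
  qed
  \<comment> \<open>For \<open>T_max \<le> T\<close> this is an identity of terms; otherwise the
    appended zero vectors add only the scalar product of a zero difference.\<close>
  have "(concat_embedding d_e d_p u_e u_p T_max T x - concat_embedding d_e d_p u_e u_p T_max T y)
      \<bullet> (concat_embedding d_e d_p u_e u_p T_max T x - concat_embedding d_e d_p u_e u_p T_max T y)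
    = (?c x - ?c y) \<bullet> (?c x - ?c y)"
    using scalar_prod_self_append_diff[OF c[OF x] c[OF y] zero_carrier_vec zero_carrier_vec,
        of "(d_e + d_p) * (T_max - T)"]
    by (cases "T_max \<le> T") (simp_all add: concat_embedding_def min_def del: upt_Suc)
  also have "\<dots> = (\<Sum>t\<leftarrow>[1..<?n + 1]. (?f x t - ?f y t) \<bullet> (?f x t - ?f y t))"
    using f x y by (intro scalar_prod_self_concat_vecs_diff[where n = "d_e + d_p"]) auto
  also have "\<dots> = (\<Sum>t\<in>{1..?n}. (?f x t - ?f y t) \<bullet> (?f x t - ?f y t))"
    by (simp only: sum_set_upt_conv_sum_list_nat[symmetric] set_upt
        atLeastLessThanSuc_atLeastAtMost Suc_eq_plus1[symmetric])
  also have "\<dots> = (\<Sum>t\<in>{1..?n}. (u_e (x t) - u_e (y t)) \<bullet> (u_e (x t) - u_e (y t)))"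
    using ue x y p
    by (intro sum.cong refl scalar_prod_self_token_position_diff[where d_e = d_e and d_p = d_p]) auto
  finally show ?thesis .
qed

lemma scalar_prod_self_nonneg: "v \<bullet> v \<ge> 0" for v :: "real vec"
  by (simp add: scalar_prod_def sum_nonneg)

lemma euclidean_norm_le_max_token_distance:
  assumes "j \<in> {1..D}" "k \<in> {1..D}" "j \<noteq> k"
  shows "euclidean_norm (u_e j - u_e k) \<le> max_token_distance D u_e"
proof -
  let ?A = "{euclidean_norm (u_e j - u_e k) | j k. j \<in> {1..D} \<and> k \<in> {1..D} \<and> j \<noteq> k}"
  have "?A \<subseteq> (\<lambda>(j, k). euclidean_norm (u_e j - u_e k)) ` ({1..D} \<times> {1..D})"
    by auto
  then have "finite ?A"
    by (rule finite_subset) simp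
  moreover have "euclidean_norm (u_e j - u_e k) \<in> ?A"
    using assms by blast
  ultimately have "euclidean_norm (u_e j - u_e k) \<le> Max ?A"
    by (rule Max_ge)
  \<comment> \<open>Two distinct tokens in \<open>{1..D}\<close> force \<open>D \<ge> 2\<close>,
    which selects the \<open>Max\<close> branch of the definition.\<close>
  then show ?thesis
    using assms by (simp add: max_token_distance_def)
qed

text \<open>Needed at the very end, where the square root of the squared maximum must be the maximum
  itself and not only its absolute value.\<close>

lemma max_token_distance_nonneg: "max_token_distance D u_e \<ge> 0"
proof (cases "D \<ge> 2")
  case True
  have "0 \<le> euclidean_norm (u_e 1 - u_e 2)"
    by (simp add: euclidean_norm_def scalar_prod_self_nonneg)
  also have "\<dots> \<le> max_token_distance D u_e"
    using True by (intro euclidean_norm_le_max_token_distance) auto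
  finally show ?thesis .
qed (simp add: max_token_distance_def)

theorem proposition3p1:
  fixes D T T_max d_e d_p :: nat
    and u_e u_p :: "nat \<Rightarrow> real vec"
    and x x' :: "nat \<Rightarrow> nat"
    and S :: "nat set"
  assumes "u_e \<in> {1..D} \<rightarrow> carrier_vec d_e"
    and "u_p \<in> {1..} \<rightarrow> carrier_vec d_p"
    and "T_max \<ge> 1"
    and "x \<in> documents D T"
    and "S \<subseteq> {1..T}"
    and "x' \<in> perturbations D T S x"
  shows "euclidean_norm (concat_embedding d_e d_p u_e u_p T_max T x
            - concat_embedding d_e d_p u_e u_p T_max T x')
         \<le> max_token_distance D u_e * sqrt (real (min (card S) T_max))"
proof -
  let ?M = "max_token_distance D u_e"
  let ?I = "{1..min T T_max}"
  let ?q = "\<lambda>t. (u_e (x t) - u_e (x' t)) \<bullet> (u_e (x t) - u_e (x' t))"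
  have x': "x' \<in> documents D T" and same: "\<And>t. t \<in> {1..T} - S \<Longrightarrow> x' t = x t"
    using assms(6) by (auto simp: perturbations_def)
  have tok: "x t \<in> {1..D}" "x' t \<in> {1..D}" if "t \<in> {1..T}" for t
    using assms(4) x' that unfolding documents_def by blast+
  have q0: "?q t = 0" if "t \<in> {1..T}" "x t = x' t" for t
  proof -
    have "u_e (x t) \<in> carrier_vec d_e"
      using assms(1) tok[OF that(1)] by blast
    then show ?thesis
      using that(2) by simp
  qed
  \<comment> \<open>The maximum ranges over distinct tokens only, so a position where the tokens
    agree is bounded separately, by \<open>0 \<le> ?M\<^sup>2\<close>.\<close>
  have qM: "?q t \<le> ?M\<^sup>2" if "t \<in> {1..T}" for t
  proof (cases "x t = x' t")
    case False
    have "sqrt (?q t) \<le> ?M"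
      using euclidean_norm_le_max_token_distance[OF tok[OF that] False, of u_e]
      by (simp add: euclidean_norm_def)
    then show ?thesis
      by (simp add: sqrt_le_D)
  next
    case True
    show ?thesis
      unfolding q0[OF that True] by (rule zero_le_power2)
  qed
  have "finite S"
    using assms(5) finite_subset by blast
  then have "card (?I \<inter> S) \<le> card S"
    by (simp add: card_mono)
  \<comment> \<open>The embedding sees only \<open>?I\<close>, which has \<open>min T T_max\<close>
    elements.\<close>
  moreover have "card (?I \<inter> S) \<le> T_max"
    using card_mono[of ?I "?I \<inter> S"] by simp
  ultimately have card: "card (?I \<inter> S) \<le> min (card S) T_max"
    by simp
  \<comment> \<open>A position of \<open>?I\<close> outside S is unperturbed, so the sum shrinks to
    \<open>?I \<inter> S\<close>.\<close>
  have "?q t = 0" if "t \<in> ?I - ?I \<inter> S" for t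
    using that by (intro q0 same[symmetric]) auto
  then have "(\<Sum>t\<in>?I. ?q t) = (\<Sum>t\<in>?I \<inter> S. ?q t)"
    by (intro sum.mono_neutral_right) auto
  also have "\<dots> \<le> real (card (?I \<inter> S)) * ?M\<^sup>2"
    using qM by (intro sum_bounded_above) auto
  also have "\<dots> \<le> ?M\<^sup>2 * real (min (card S) T_max)"
    using card by (subst mult.commute) (intro mult_left_mono of_nat_mono, simp_all)
  finally have "sqrt (\<Sum>t\<in>?I. ?q t) \<le> sqrt (?M\<^sup>2 * real (min (card S) T_max))"
    by (rule real_sqrt_le_mono)
  then show ?thesis
    unfolding euclidean_norm_def
      scalar_prod_self_concat_embedding_diff[OF assms(1,2,4) x']
    by (simp add: real_sqrt_mult max_token_distance_nonneg)
qed

end
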